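(* Let $\Sigma=\{0,\dots,k-1\}$, $k\ge2$, and let $\alpha$ be a probability measure on $\Sigma$. Then for every $\alpha$-normal sequence $R\in\Sigma^\infty$, \[\dim_{\mathrm{FS}}(R)=\mathrm{Dim}_{\mathrm{FS}}(R)=\mathcal{H}_k(\alpha),\] where $\mathcal{H}_k(\alpha)=\sum_{a\in\Sigma}\alpha(a)\log_k\frac{1}{\alpha(a)}$ (with $0\log\frac10=0$).
   Context: $\alpha(w)=\prod_i\alpha(w[i])$; $\mu$ is the uniform measure, $\mu(w)=k^{-|w|}$. A finite-state gambler (FSG) is $G=(Q,\delta,q_0,B)$ with $Q$ finite, $\delta:Q\times\Sigma\to Q$, $q_0\in Q$, and $B$ assigning to each state a rational-valued probability measure on $\Sigma$; $\delta(w)$ is the state reached from $q_0$ on $w$. Its martingale is $d_G(\lambda)=1$, $d_G(wa)=k\,d_G(w)B(\delta(w))(a)$, and $d^{(s)}_{G}(w)=\mu(w)^{1-s}d_G(w)$. $\dim_{\mathrm{FS}}(S)$ (resp. $\mathrm{Dim}_{\mathrm{FS}}(S)$) is the infimum of $s\ge0$ such that some FSG $G$ has $\limsup_n d^{(s)}_{G}(S[0..n-1])=\infty$ (resp. $\liminf_n d^{(s)}_{G}(S[0..n-1])=\infty$). For nonempty $w$ and $n\ge1$, $\pi_{S,n}(w)$ is $\frac1n$ times the number of $m\in\{0,\dots,n-1\}$ with $S[m|w|..(m+1)|w|-1]=w$. $S$ is $\alpha$-normal if $\lim_{n}\pi_{S,n}(w)=\alpha(w)$ for every nonempty $w\in\Sigma^*$.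 *)

theory Defs
  imports "HOL-Probability.Probability"
begin

text \<open>
  The alphabet \<open>\<Sigma> = {0, \<dots>, k - 1}\<close> is \<open>{..<k} :: nat set\<close>, words are lists over it, and an
  infinite sequence is a function \<open>S :: nat \<Rightarrow> nat\<close> with \<open>S i < k\<close> for all \<open>i\<close>. A probability
  measure on \<open>\<Sigma>\<close> is a \<open>nat pmf\<close> supported in \<open>{..<k}\<close>.
\<close>

definition word_prob :: "nat pmf \<Rightarrow> nat list \<Rightarrow> real"
  where "word_prob \<alpha> w = (\<Prod>i<length w. pmf \<alpha> (w ! i))"

definition unif_word_prob :: "nat \<Rightarrow> nat list \<Rightarrow> real"
  where "unif_word_prob k w = 1 / real k ^ length w"

lemma unif_word_prob_eq:
  assumes "set w \<subseteq> {..<k}"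
  shows "unif_word_prob k w = word_prob (pmf_of_set {..<k}) w"
proof (cases "w = []")
  case False
  with assms have "k > 0" by (cases w) auto
  have "pmf (pmf_of_set {..<k}) (w ! i) = 1 / real k" if "i < length w" for i
  proof -
    have "w ! i \<in> {..<k}" using assms that by (meson nth_mem subsetD)
    then show ?thesis using \<open>k > 0\<close> by (subst pmf_of_set) (auto simp: indicator_def)
  qed
  then show ?thesis by (simp add: unif_word_prob_def word_prob_def power_one_over)
qed (simp add: unif_word_prob_def word_prob_def)

definition seq_prefix :: "(nat \<Rightarrow> nat) \<Rightarrow> nat \<Rightarrow> nat list"
  where "seq_prefix S n = map S [0..<n]"


subsection \<open>Finite-state gamblers\<close>

record 'q gambler =
  states :: "'q set"
  trans :: "'q \<Rightarrow> nat \<Rightarrow> 'q"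
  start :: 'q
  bet :: "'q \<Rightarrow> nat pmf"

definition FSG :: "nat \<Rightarrow> 'q gambler \<Rightarrow> bool"
  where "FSG k G \<longleftrightarrow>
    finite (states G) \<and> start G \<in> states G \<and>
    (\<forall>q \<in> states G. \<forall>a < k. trans G q a \<in> states G) \<and>
    (\<forall>q \<in> states G. set_pmf (bet G q) \<subseteq> {..<k} \<and> (\<forall>a < k. pmf (bet G q) a \<in> \<rat>))"

definition run :: "'q gambler \<Rightarrow> nat list \<Rightarrow> 'q"
  where "run G w = foldl (trans G) (start G) w"

function martingale :: "nat \<Rightarrow> 'q gambler \<Rightarrow> nat list \<Rightarrow> real"
  where
    "martingale k G [] = 1"
  | "martingale k G (w @ [a]) = real k * martingale k G w * pmf (bet G (run G w)) a"
  by (auto, metis rev_exhaust)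
termination by (relation "Wellfounded.measure (\<lambda>(k, G, w). length w)") auto

definition s_gale :: "nat \<Rightarrow> 'q gambler \<Rightarrow> real \<Rightarrow> nat list \<Rightarrow> real"
  where "s_gale k G s w = unif_word_prob k w powr (1 - s) * martingale k G w"


subsection \<open>Finite-state dimension and strong dimension\<close>

text \<open>
  A definition cannot quantify over state types, so the states are taken to be natural numbers;
  \<open>FSG_nat_states\<close> below shows that this loses no gambler. The sets are bounded below
  by \<open>0\<close> and, for \<open>k \<ge> 2\<close>, nonempty (\<open>FSG_succeeds\<close>), so the infima
  in \<open>real\<close> are genuine.
\<close>

definition dim_FS :: "nat \<Rightarrow> (nat \<Rightarrow> nat) \<Rightarrow> real"
  where "dim_FS k S = Inf {s. s \<ge> 0 \<and> (\<exists>G :: nat gambler. FSG k G \<and>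
    limsup (\<lambda>n. ereal (s_gale k G s (seq_prefix S n))) = \<infinity>)}"

definition Dim_FS :: "nat \<Rightarrow> (nat \<Rightarrow> nat) \<Rightarrow> real"
  where "Dim_FS k S = Inf {s. s \<ge> 0 \<and> (\<exists>G :: nat gambler. FSG k G \<and>
    liminf (\<lambda>n. ereal (s_gale k G s (seq_prefix S n))) = \<infinity>)}"

lemma FSG_nat_states:
  fixes G :: "'q gambler"
  assumes "FSG k G"
  obtains G' :: "nat gambler" where "FSG k G'"
    and "\<And>w. set w \<subseteq> {..<k} \<Longrightarrow> martingale k G' w = martingale k G w"
proof -
  have fin: "finite (states G)" using assms by (simp add: FSG_def)
  obtain f :: "'q \<Rightarrow> nat" where inj: "inj_on f (states G)"
    using finite_imp_inj_to_nat_seg[OF fin] by blast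
  define g where "g = inv_into (states G) f"
  have g: "g (f q) = q" if "q \<in> states G" for q
    using inj that by (simp add: g_def)
  define G' :: "nat gambler" where "G' = \<lparr>states = f ` states G,
    trans = (\<lambda>q a. f (trans G (g q) a)), start = f (start G), bet = (\<lambda>q. bet G (g q))\<rparr>"
  have "FSG k G'"
    using assms g by (auto simp: FSG_def G'_def)
  moreover have run: "run G w \<in> states G \<and> run G' w = f (run G w)" if "set w \<subseteq> {..<k}" for w
    using that
  proof (induction w rule: rev_induct)
    case Nil
    then show ?case using assms by (simp add: run_def G'_def FSG_def)
  next
    case (snoc a w)
    then show ?case using assms g by (auto simp: run_def G'_def FSG_def)
  qed
  have "martingale k G' w = martingale k G w" if "set w \<subseteq> {..<k}" for w
    using that
  proof (induction w rule: rev_induct)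
    case (snoc a w)
    then show ?case using run[of w] g by (simp add: G'_def)
  qed simp
  ultimately show ?thesis using that by blast
qed

lemma FSG_succeeds:
  assumes "k \<ge> 2" and "\<forall>i. S i < k" and "s > 1"
  shows "\<exists>G :: nat gambler. FSG k G \<and>
    liminf (\<lambda>n. ereal (s_gale k G s (seq_prefix S n))) = \<infinity> \<and>
    limsup (\<lambda>n. ereal (s_gale k G s (seq_prefix S n))) = \<infinity>"
proof -
  define G :: "nat gambler" where "G = \<lparr>states = {0}, trans = (\<lambda>_ _. 0), start = 0,
    bet = (\<lambda>_. pmf_of_set {..<k})\<rparr>"
  have ne: "{..<k} \<noteq> {}" using assms(1) by (simp add: lessThan_empty_iff)
  have G: "FSG k G"
    using ne by (auto simp: FSG_def G_def indicator_def)
  have m: "martingale k G w = 1" if "set w \<subseteq> {..<k}" for w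
    using that
  proof (induction w rule: rev_induct)
    case (snoc a w)
    then show ?case using ne by (auto simp: G_def)
  qed simp
  have sg: "s_gale k G s (seq_prefix S n) = (real k powr (s - 1)) ^ n" for n
  proof -
    have k: "real k > 0" using assms(1) by simp
    have "set (seq_prefix S n) \<subseteq> {..<k}" using assms(2) by (auto simp: seq_prefix_def)
    then have "s_gale k G s (seq_prefix S n) = (1 / real k ^ n) powr (1 - s)"
      by (simp add: s_gale_def m unif_word_prob_def) (simp add: seq_prefix_def)
    also have "1 / real k ^ n = real k powr (- real n)"
      using k by (simp add: powr_minus_divide powr_realpow)
    also have "\<dots> powr (1 - s) = (real k powr (s - 1)) powr real n"
      by (simp add: powr_powr algebra_simps)
    also have "\<dots> = (real k powr (s - 1)) ^ n" using k by (simp add: powr_realpow)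
    finally show ?thesis .
  qed
  have "1 < real k powr (s - 1)"
    using assms by (intro gr_one_powr) auto
  then have "filterlim (\<lambda>n. (real k powr (s - 1)) ^ n) at_top sequentially"
    by (intro filterlim_at_infinity_imp_filterlim_at_top filterlim_realpow_sequentially_gt1)
       (use assms(1) in \<open>auto intro!: always_eventually zero_less_power\<close>)
  then have "(\<lambda>n. ereal (s_gale k G s (seq_prefix S n))) \<longlonglongrightarrow> \<infinity>"
    by (simp add: sg tendsto_PInfty_eq_at_top)
  then show ?thesis
    using G lim_imp_Liminf lim_imp_Limsup trivial_limit_sequentially by blast
qed


subsection \<open>Normality and entropy\<close>

text \<open>Relative frequency of \<open>w\<close> among the first \<open>n\<close> disjoint, aligned blocks of length \<open>|w|\<close>.\<close>

definition block_freq :: "(nat \<Rightarrow> nat) \<Rightarrow> nat \<Rightarrow> nat list \<Rightarrow> real"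
  where "block_freq S n w =
    1 / real n * real (card {m. m < n \<and> map S [m * length w ..< (m + 1) * length w] = w})"

definition normal_seq :: "nat \<Rightarrow> nat pmf \<Rightarrow> (nat \<Rightarrow> nat) \<Rightarrow> bool"
  where "normal_seq k \<alpha> S \<longleftrightarrow>
    (\<forall>w. w \<noteq> [] \<and> set w \<subseteq> {..<k} \<longrightarrow> (\<lambda>n. block_freq S n w) \<longlonglongrightarrow> word_prob \<alpha> w)"

text \<open>The convention \<open>0 log (1/0) = 0\<close> holds automatically, since the factor \<open>pmf \<alpha> a\<close> is \<open>0\<close>.\<close>

definition entropy_base :: "nat \<Rightarrow> nat pmf \<Rightarrow> real"
  where "entropy_base k \<alpha> = (\<Sum>a<k. pmf \<alpha> a * log (real k) (1 / pmf \<alpha> a))"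

end

theory Submission
  imports Defs
begin

text \<open>
  For the upper bound, a one-state gambler betting a positive rational approximation \<open>\<beta>\<close> of \<open>\<alpha>\<close>
  has growth rate \<open>1\<close> minus the cross entropy of \<open>\<alpha>\<close> and \<open>\<beta>\<close> (to base \<open>k\<close>), which tends to the
  entropy of \<open>\<alpha>\<close> as \<open>\<beta>\<close> approaches \<open>\<alpha>\<close>.

  For the lower bound, cut \<open>R\<close> into aligned blocks of length \<open>l\<close>. On a block \<open>w\<close> a gambler with
  state set \<open>Q\<close> multiplies its capital by at most \<open>D w = 1 + (\<Sum>q\<in>Q. d\<^sub>q w)\<close>, where \<open>d\<^sub>q\<close> is its
  martingale started in \<open>q\<close>. This bound no longer depends on the state, so normality turns the
  growth rate per block into the \<open>\<alpha>\<close>-average of \<open>ln (D w)\<close>. As \<open>D\<close> has total mass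
  \<open>(1 + |Q|) k ^ l\<close>, Gibbs' inequality bounds that average by
  \<open>l ln k + ln (1 + |Q|)\<close> minus \<open>l\<close> times the entropy, and the \<open>|Q|\<close>-term disappears per letter
  as \<open>l\<close> grows.
\<close>

subsection \<open>Sums over words of fixed length\<close>

definition words :: "nat \<Rightarrow> nat \<Rightarrow> nat list set"
  where "words k l = {w. set w \<subseteq> {..<k} \<and> length w = l}"

lemma finite_words [simp]: "finite (words k l)"
  unfolding words_def by (rule finite_lists_length_eq) simp

lemma words_0 [simp]: "words k 0 = {[]}"
  by (auto simp: words_def)

lemma words_Suc: "words k (Suc l) = (\<lambda>(w, a). w @ [a]) ` (words k l \<times> {..<k})"
proof
  show "words k (Suc l) \<subseteq> (\<lambda>(w, a). w @ [a]) ` (words k l \<times> {..<k})"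
  proof
    fix w assume w: "w \<in> words k (Suc l)"
    then obtain v a where "w = v @ [a]" by (cases w rule: rev_cases) (auto simp: words_def)
    with w show "w \<in> (\<lambda>(w, a). w @ [a]) ` (words k l \<times> {..<k})"
      by (auto simp: words_def image_iff)
  qed
qed (auto simp: words_def)

lemma sum_words_Suc:
  fixes f :: "nat list \<Rightarrow> real"
  shows "sum f (words k (Suc l)) = (\<Sum>w\<in>words k l. \<Sum>a<k. f (w @ [a]))"
proof -
  have "inj_on (\<lambda>(w, a). w @ [a]) (words k l \<times> {..<k})"
    by (auto simp: inj_on_def)
  then show ?thesis
    unfolding words_Suc
    by (subst sum.reindex) (simp_all add: sum.cartesian_product case_prod_beta)
qed

lemma sum_pmf_lessThan:
  fixes p :: "nat pmf"
  assumes "set_pmf p \<subseteq> {..<k}"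
  shows "(\<Sum>a<k. pmf p a) = 1"
  using assms by (intro sum_pmf_eq_1) auto

lemma word_prob_snoc: "word_prob \<alpha> (w @ [a]) = word_prob \<alpha> w * pmf \<alpha> a"
  by (simp add: word_prob_def nth_append)

lemma word_prob_nonneg: "word_prob \<alpha> w \<ge> 0"
  by (simp add: word_prob_def prod_nonneg)

lemma sum_word_prob:
  assumes "set_pmf \<alpha> \<subseteq> {..<k}"
  shows "sum (word_prob \<alpha>) (words k l) = 1"
proof (induction l)
  case (Suc l)
  then show ?case
    using sum_pmf_lessThan[OF assms]
    by (simp add: sum_words_Suc word_prob_snoc flip: sum_distrib_left)
qed (simp add: word_prob_def)

text \<open>The logarithm turns the product over letters into a sum, and the letter weights sum to
  1. Up to sign this is additivity of entropy for the product measure.\<close>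

lemma word_prob_ln_word_prob:
  assumes "set_pmf \<alpha> \<subseteq> {..<k}"
  shows "(\<Sum>w\<in>words k l. word_prob \<alpha> w * ln (word_prob \<alpha> w)) =
    real l * (\<Sum>a<k. pmf \<alpha> a * ln (pmf \<alpha> a))"
proof (induction l)
  case (Suc l)
  define h where "h = (\<Sum>a<k. pmf \<alpha> a * ln (pmf \<alpha> a))"
  \<comment> \<open>The logarithm is additive only for nonzero factors; if a factor is 0, both sides
    are 0.\<close>
  have *: "word_prob \<alpha> w * pmf \<alpha> a * ln (word_prob \<alpha> w * pmf \<alpha> a) =
      word_prob \<alpha> w * ln (word_prob \<alpha> w) * pmf \<alpha> a +
      word_prob \<alpha> w * (pmf \<alpha> a * ln (pmf \<alpha> a))" for w a
    using word_prob_nonneg[of \<alpha> w] pmf_nonneg[of \<alpha> a]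
    by (cases "word_prob \<alpha> w = 0"; cases "pmf \<alpha> a = 0") (auto simp: ln_mult algebra_simps)
  have "(\<Sum>w\<in>words k (Suc l). word_prob \<alpha> w * ln (word_prob \<alpha> w)) =
    (\<Sum>w\<in>words k l. word_prob \<alpha> w * ln (word_prob \<alpha> w) + word_prob \<alpha> w * h)"
    using sum_pmf_lessThan[OF assms]
    by (simp add: sum_words_Suc word_prob_snoc * sum.distrib h_def flip: sum_distrib_left)
  also have "\<dots> = real l * h + h"
    using Suc.IH sum_word_prob[OF assms, of l]
    by (simp add: sum.distrib h_def flip: sum_distrib_right)
  finally show ?case by (simp add: h_def algebra_simps)
qed (simp add: word_prob_def)

text \<open>Sum \<open>ln x \<le> x - 1\<close> at \<open>x = q / p\<close> with weights
  \<open>p\<close>; no normalisation enters beyond the comparison of total masses. Positivity of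
  \<open>q\<close> matters because \<open>ln 0 = 0\<close> could otherwise break the
  inequality.\<close>

lemma gibbs_inequality:
  fixes p q :: "'a \<Rightarrow> real"
  assumes "\<And>x. x \<in> A \<Longrightarrow> p x \<ge> 0" and "\<And>x. x \<in> A \<Longrightarrow> q x > 0"
    and "sum q A \<le> sum p A"
  shows "(\<Sum>x\<in>A. p x * ln (q x)) \<le> (\<Sum>x\<in>A. p x * ln (p x))"
proof -
  have "p x * ln (q x) - p x * ln (p x) \<le> q x - p x" if "x \<in> A" for x
  proof (cases "p x = 0")
    case False
    with assms that have pos: "p x > 0" "q x > 0" by (auto simp: less_le)
    then have "p x * ln (q x) - p x * ln (p x) = p x * ln (q x / p x)"
      by (simp add: ln_div algebra_simps)
    also have "\<dots> \<le> p x * (q x / p x - 1)"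
      using pos by (intro mult_left_mono ln_le_minus_one) auto
    finally show ?thesis using pos by (simp add: algebra_simps)
  qed (use assms(2)[OF that] in simp)
  then have "(\<Sum>x\<in>A. p x * ln (q x) - p x * ln (p x)) \<le> (\<Sum>x\<in>A. q x - p x)"
    by (rule sum_mono)
  with assms(3) show ?thesis by (simp add: sum_subtractf)
qed

lemma entropy_base_ln:
  "entropy_base k \<alpha> * ln (real k) = - (\<Sum>a<k. pmf \<alpha> a * ln (pmf \<alpha> a))" if "k \<ge> 2"
proof -
  have "pmf \<alpha> a * log (real k) (1 / pmf \<alpha> a) * ln (real k) = - (pmf \<alpha> a * ln (pmf \<alpha> a))" for a
    using that pmf_nonneg[of \<alpha> a]
    by (cases "pmf \<alpha> a = 0") (auto simp: log_def ln_div)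
  then show ?thesis
    unfolding entropy_base_def by (simp add: sum_distrib_right sum_negf)
qed

lemma entropy_base_nonneg: "entropy_base k \<alpha> \<ge> 0" if "k \<ge> 2"
  unfolding entropy_base_def
proof (rule sum_nonneg)
  fix a
  show "0 \<le> pmf \<alpha> a * log (real k) (1 / pmf \<alpha> a)"
    using that pmf_nonneg[of \<alpha> a] pmf_le_1[of \<alpha> a] by (cases "pmf \<alpha> a = 0") auto
qed


subsection \<open>Block averages along a normal sequence\<close>

definition block :: "(nat \<Rightarrow> nat) \<Rightarrow> nat \<Rightarrow> nat \<Rightarrow> nat list"
  where "block S l m = map S [m * l..<(m + 1) * l]"

lemma block_in_words: "block S l m \<in> words k l" if "\<forall>i. S i < k"
  using that by (auto simp: block_def words_def)

lemma seq_prefix_add: "seq_prefix S (m + n) = seq_prefix S m @ map S [m..<m + n]"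
  unfolding seq_prefix_def by (simp add: upt_add_eq_append[of 0 m n, simplified])

lemma seq_prefix_Suc_blocks: "seq_prefix S (Suc m * l) = seq_prefix S (m * l) @ block S l m"
  using seq_prefix_add[of S "m * l" l] by (simp add: block_def add.commute)

text \<open>Grouping the block indices by their word turns the average into a finite combination of
  block frequencies, each convergent by normality. Normality speaks of nonempty words only, hence
  \<open>l > 0\<close>.\<close>

lemma block_average_tendsto:
  assumes "normal_seq k \<alpha> R" and "\<forall>i. R i < k" and "l > 0"
  shows "(\<lambda>n. (\<Sum>m<n. f (block R l m)) / real n) \<longlonglongrightarrow> (\<Sum>w\<in>words k l. word_prob \<alpha> w * f w)"
proof -
  have "(\<Sum>m<n. f (block R l m)) / real n = (\<Sum>w\<in>words k l. block_freq R n w * f w)" for n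
  proof -
    have "(\<Sum>m<n. f (block R l m)) =
        (\<Sum>w\<in>words k l. \<Sum>m\<in>{m. m \<in> {..<n} \<and> block R l m = w}. f (block R l m))"
      by (rule sum.group[symmetric]) (use block_in_words[OF assms(2)] in auto)
    also have "\<dots> = (\<Sum>w\<in>words k l. real (card {m. m < n \<and> block R l m = w}) * f w)"
      by (intro sum.cong) auto
    finally show ?thesis
      by (simp add: sum_divide_distrib block_freq_def block_def words_def)
  qed
  moreover have "(\<lambda>n. \<Sum>w\<in>words k l. block_freq R n w * f w)
      \<longlonglongrightarrow> (\<Sum>w\<in>words k l. word_prob \<alpha> w * f w)"
  proof (intro tendsto_sum tendsto_mult tendsto_const)
    fix w assume "w \<in> words k l"
    then show "(\<lambda>n. block_freq R n w) \<longlonglongrightarrow> word_prob \<alpha> w"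
      using assms by (auto simp: normal_seq_def words_def)
  qed
  ultimately show ?thesis by simp
qed


subsection \<open>Martingales of gamblers\<close>

lemma martingale_nonneg: "martingale k G w \<ge> 0"
  by (induction w rule: rev_induct) auto

lemma run_in_states:
  assumes "FSG k G" and "set w \<subseteq> {..<k}"
  shows "run G w \<in> states G"
  using assms(2)
proof (induction w rule: rev_induct)
  case Nil
  then show ?case using assms(1) by (simp add: run_def FSG_def)
next
  case (snoc a w)
  then show ?case using assms(1) by (simp add: run_def FSG_def)
qed

lemma FSG_start_update: "FSG k (G\<lparr>start := q\<rparr>)" if "FSG k G" and "q \<in> states G"
  using that by (simp add: FSG_def)

text \<open>After \<open>u\<close> the bets are those of the gambler restarted in
  \<open>run G u\<close> with capital 1, so gains multiply.\<close>

lemma martingale_append: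
  "martingale k G (u @ v) = martingale k G u * martingale k (G\<lparr>start := run G u\<rparr>) v"
proof (induction v rule: rev_induct)
  case (snoc a v)
  have "run G (u @ v) = run (G\<lparr>start := run G u\<rparr>) v"
    by (simp add: run_def)
  with snoc show ?case
    by (simp flip: append_assoc)
qed simp

text \<open>One bet multiplies the capital by at most \<open>k\<close>. This crude bound handles the
  incomplete last block.\<close>

lemma martingale_le: "martingale k G w \<le> real k ^ length w"
proof (induction w rule: rev_induct)
  case (snoc a w)
  have "martingale k G (w @ [a]) = real k * (martingale k G w * pmf (bet G (run G w)) a)"
    by simp
  also have "\<dots> \<le> real k * (real k ^ length w * 1)"
    by (intro mult_left_mono mult_mono snoc) (auto simp: pmf_le_1)
  finally show ?case by simp
qed simp

text \<open>Fairness: the bets in a reachable state sum to 1 over the alphabet, so the mean capital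
  stays 1.\<close>

lemma sum_martingale_words:
  assumes "FSG k G"
  shows "sum (martingale k G) (words k l) = real k ^ l"
proof (induction l)
  case (Suc l)
  have "(\<Sum>a<k. martingale k G (w @ [a])) = real k * martingale k G w" if "w \<in> words k l" for w
  proof -
    have "run G w \<in> states G"
      using run_in_states[OF assms] that by (simp add: words_def)
    then have "(\<Sum>a<k. pmf (bet G (run G w)) a) = 1"
      using assms by (intro sum_pmf_lessThan) (simp add: FSG_def)
    then show ?thesis by (simp flip: sum_distrib_left)
  qed
  then have "sum (martingale k G) (words k (Suc l)) =
      (\<Sum>w\<in>words k l. real k * martingale k G w)"
    unfolding sum_words_Suc by (intro sum.cong refl)
  then show ?case
    using Suc by (simp flip: sum_distrib_left)
qed simp

text \<open>The summand \<open>1\<close> only serves to make the logarithm finite.\<close>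

definition state_mass :: "nat \<Rightarrow> 'q gambler \<Rightarrow> nat list \<Rightarrow> real"
  where "state_mass k G w = 1 + (\<Sum>q\<in>states G. martingale k (G\<lparr>start := q\<rparr>) w)"

lemma state_mass_ge_1: "state_mass k G w \<ge> 1"
  by (simp add: state_mass_def sum_nonneg martingale_nonneg)

lemma card_words: "card (words k l) = k ^ l"
  unfolding words_def using card_lists_length_eq[of "{..<k}" l] by simp

lemma sum_state_mass:
  assumes "FSG k G"
  shows "sum (state_mass k G) (words k l) = (1 + real (card (states G))) * real k ^ l"
proof -
  have "sum (state_mass k G) (words k l) =
      real k ^ l + (\<Sum>q\<in>states G. sum (martingale k (G\<lparr>start := q\<rparr>)) (words k l))"
    unfolding state_mass_def
    by (simp add: sum.distrib card_words sum.swap[of _ "words k l"])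
  also have "\<dots> = real k ^ l + (\<Sum>q\<in>states G. real k ^ l)"
    by (intro arg_cong2[where f = "(+)"] refl sum.cong sum_martingale_words
        FSG_start_update[OF assms])
  finally show ?thesis by (simp add: algebra_simps)
qed

text \<open>The state reached after \<open>u\<close> is one of those summed over, and the other
  summands are nonnegative.\<close>

lemma martingale_append_le_state_mass:
  assumes "FSG k G" and "set u \<subseteq> {..<k}"
  shows "martingale k G (u @ v) \<le> martingale k G u * state_mass k G v"
proof -
  have "finite (states G)" using assms(1) by (simp add: FSG_def)
  then have "martingale k (G\<lparr>start := run G u\<rparr>) v \<le>
      (\<Sum>q\<in>states G. martingale k (G\<lparr>start := q\<rparr>) v)"
    using run_in_states[OF assms] by (intro member_le_sum) (auto simp: martingale_nonneg)
  also have "\<dots> \<le> state_mass k G v" by (simp add: state_mass_def)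
  finally show ?thesis
    unfolding martingale_append by (intro mult_left_mono martingale_nonneg)
qed

text \<open>The logarithms are taken of the block bounds, which are at least 1; the martingale
  itself may vanish. The exponent is a block sum to which normality applies.\<close>

lemma martingale_blocks_le:
  assumes "FSG k G" and "\<forall>i. R i < k"
  shows "martingale k G (seq_prefix R (m * l)) \<le> exp (\<Sum>j<m. ln (state_mass k G (block R l j)))"
proof (induction m)
  case 0
  then show ?case by (simp add: seq_prefix_def)
next
  case (Suc m)
  have "set (seq_prefix R (m * l)) \<subseteq> {..<k}" using assms(2) by (auto simp: seq_prefix_def)
  then have "martingale k G (seq_prefix R (Suc m * l)) \<le>
      martingale k G (seq_prefix R (m * l)) * state_mass k G (block R l m)"
    unfolding seq_prefix_Suc_blocks by (rule martingale_append_le_state_mass[OF assms(1)])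
  also have "\<dots> \<le> exp (\<Sum>j<m. ln (state_mass k G (block R l j))) * state_mass k G (block R l m)"
    using state_mass_ge_1[of k G "block R l m"] by (intro mult_right_mono Suc) auto
  also have "\<dots> = exp (\<Sum>j<Suc m. ln (state_mass k G (block R l j)))"
    using state_mass_ge_1[of k G "block R l m"] by (simp add: exp_add)
  finally show ?case .
qed

lemma s_gale_seq_prefix:
  assumes "k \<ge> 2"
  shows "s_gale k G s (seq_prefix R n) =
    exp ((s - 1) * real n * ln (real k)) * martingale k G (seq_prefix R n)"
proof -
  have "(1 / real k ^ n) powr (1 - s) = exp ((s - 1) * real n * ln (real k))"
    using assms by (simp add: powr_def ln_div ln_realpow algebra_simps)
  then show ?thesis by (simp add: s_gale_def unif_word_prob_def seq_prefix_def)
qed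


subsection \<open>Lower bound\<close>

lemma average_ln_state_mass_le:
  assumes "k \<ge> 2" and "set_pmf \<alpha> \<subseteq> {..<k}" and "FSG k G"
  shows "(\<Sum>w\<in>words k l. word_prob \<alpha> w * ln (state_mass k G w)) \<le>
    ln (1 + real (card (states G))) + real l * ln (real k) * (1 - entropy_base k \<alpha>)"
proof -
  \<comment> \<open>The total mass of \<open>state_mass\<close> over words of length
    \<open>l\<close>; dividing by it makes Gibbs' inequality applicable.\<close>
  define c where "c = (1 + real (card (states G))) * real k ^ l"
  have c: "c > 0" using assms(1) by (simp add: c_def)
  have pos: "state_mass k G w > 0" for w using state_mass_ge_1[of k G w] by linarith
  have "(\<Sum>w\<in>words k l. word_prob \<alpha> w * ln (state_mass k G w / c)) \<le>
      (\<Sum>w\<in>words k l. word_prob \<alpha> w * ln (word_prob \<alpha> w))"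
  proof (rule gibbs_inequality)
    show "(\<Sum>w\<in>words k l. state_mass k G w / c) \<le> sum (word_prob \<alpha>) (words k l)"
      using sum_state_mass[OF assms(3), of l] c
      by (simp add: sum_word_prob[OF assms(2)] c_def flip: sum_divide_distrib)
  qed (use c pos word_prob_nonneg in auto)
  also have "\<dots> = - (real l * (entropy_base k \<alpha> * ln (real k)))"
    by (simp add: word_prob_ln_word_prob[OF assms(2)] entropy_base_ln[OF assms(1)])
  also have "(\<Sum>w\<in>words k l. word_prob \<alpha> w * ln (state_mass k G w / c)) =
      (\<Sum>w\<in>words k l. word_prob \<alpha> w * ln (state_mass k G w)) - ln c"
    using c pos sum_word_prob[OF assms(2), of l]
    by (simp add: ln_divide_pos right_diff_distrib sum_subtractf flip: sum_distrib_right)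
  also have "ln c = ln (1 + real (card (states G))) + real l * ln (real k)"
    using assms(1) by (simp add: c_def ln_mult ln_realpow)
  finally show ?thesis by (simp add: algebra_simps)
qed

lemma s_gale_eventually_bounded:
  assumes "k \<ge> 2" and "set_pmf \<alpha> \<subseteq> {..<k}" and "\<forall>i. R i < k" and "normal_seq k \<alpha> R"
    and "FSG k G" and "0 \<le> s" and "s < entropy_base k \<alpha>"
  obtains C where "eventually (\<lambda>n. s_gale k G s (seq_prefix R n) \<le> C) sequentially"
proof -
  define K where "K = ln (real k)"
  have K: "K > 0" using assms(1) by (simp add: K_def)
  define c where "c = ln (1 + real (card (states G)))"
  \<comment> \<open>Blocks are taken so long that the cost \<open>c\<close> of not knowing the state
    is below the margin \<open>l * K * (H - s)\<close>, with \<open>H\<close> the entropy.\<close>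
  obtain l :: nat where "c / (K * (entropy_base k \<alpha> - s)) < real l"
    using reals_Archimedean2 by blast
  moreover have "c \<ge> 0" by (simp add: c_def)
  ultimately have l: "c < real l * K * (entropy_base k \<alpha> - s)"
    using K assms(7) by (simp add: divide_less_eq mult.assoc)
  then have l0: "l > 0" using \<open>c \<ge> 0\<close> by (cases l) auto
  define f where "f w = ln (state_mass k G w)" for w
  have lim: "(\<lambda>n. (\<Sum>m<n. f (block R l m)) / real n) \<longlonglongrightarrow> (\<Sum>w\<in>words k l. word_prob \<alpha> w * f w)"
    by (rule block_average_tendsto[OF assms(4,3) l0])
  have "(\<Sum>w\<in>words k l. word_prob \<alpha> w * f w) < real l * K * (1 - s)"
    using average_ln_state_mass_le[OF assms(1,2,5), of l] l
    by (simp add: f_def c_def K_def algebra_simps)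
  from order_tendstoD(2)[OF lim this]
  obtain N where N: "(\<Sum>m<n. f (block R l m)) / real n < real l * K * (1 - s)" if "n \<ge> N" for n
    by (auto simp: eventually_sequentially)
  \<comment> \<open>On complete blocks the growth is outweighed by the discount. The
    \<open>r < l\<close> leftover letters gain at most \<open>k ^ r\<close> and are discounted by
    \<open>exp ((s - 1) * r * K)\<close>, which leaves \<open>exp (s * r * K)\<close>.\<close>
  show ?thesis
  proof
    show "\<forall>\<^sub>F n in sequentially. s_gale k G s (seq_prefix R n) \<le> exp (s * l * K)"
    proof (rule eventually_sequentiallyI)
      \<comment> \<open>\<open>Suc N\<close> rather than \<open>N\<close> makes the number
        \<open>m\<close> of complete blocks positive, so that one can multiply by it.\<close>
      fix n assume n: "Suc N * l \<le> n"
      define m where "m = n div l"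
      define r where "r = n mod l"
      have nmr: "n = m * l + r" and r: "r < l" using l0 by (simp_all add: m_def r_def)
      have m: "m \<ge> Suc N" using n l0 unfolding m_def by (metis div_le_mono div_mult_self_is_m)
      have "(\<Sum>j<m. f (block R l j)) < real m * (real l * K * (1 - s))"
        using N[of m] m by (simp add: divide_less_eq mult.commute)
      have "martingale k G (seq_prefix R n) \<le>
          martingale k G (seq_prefix R (m * l)) * real k ^ r"
        unfolding nmr seq_prefix_add martingale_append
        using martingale_le[of k _ "map R [m * l..<m * l + r]"]
        by (intro mult_left_mono martingale_nonneg) simp
      also have "\<dots> \<le> exp (\<Sum>j<m. f (block R l j)) * real k ^ r"
        unfolding f_def by (intro mult_right_mono martingale_blocks_le assms) simp
      also have "\<dots> \<le> exp (real m * (real l * K * (1 - s))) * real k ^ r"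
        using \<open>_ < real m * (real l * K * (1 - s))\<close> by (intro mult_right_mono) auto
      also have "real k ^ r = exp (r * K)"
        using assms(1) by (simp add: K_def exp_of_nat_mult)
      finally have "s_gale k G s (seq_prefix R n) \<le> exp ((s - 1) * real n * K) *
          (exp (real m * (real l * K * (1 - s))) * exp (r * K))"
        unfolding s_gale_seq_prefix[OF assms(1)] K_def by (intro mult_left_mono) auto
      also have "\<dots> = exp (s * r * K)"
        unfolding nmr by (simp add: algebra_simps flip: exp_add)
      also have "\<dots> \<le> exp (s * l * K)"
        using r K assms(6) by (simp add: mult_left_mono mult_right_mono)
      finally show "s_gale k G s (seq_prefix R n) \<le> exp (s * l * K)" .
    qed
  qed
qed


subsection \<open>Upper bound\<close>

lemma exists_pmf_lessThan:
  fixes f :: "nat \<Rightarrow> real"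
  assumes "\<And>a. a < k \<Longrightarrow> f a \<ge> 0" and "(\<Sum>a<k. f a) = 1"
  obtains p where "set_pmf p \<subseteq> {..<k}" and "\<And>a. a < k \<Longrightarrow> pmf p a = f a"
proof -
  define g where "g a = (if a < k then f a else 0)" for a
  have "(\<integral>\<^sup>+ a. ennreal (g a) \<partial>count_space UNIV) = (\<Sum>a<k. ennreal (g a))"
    by (rule nn_integral_count_space'[of "{..<k}"]) (auto simp: g_def)
  also have "\<dots> = ennreal (\<Sum>a<k. g a)"
    by (rule sum_ennreal) (auto simp: g_def assms)
  also have "(\<Sum>a<k. g a) = 1" using assms(2) by (simp add: g_def)
  finally have p: "pmf (embed_pmf g) a = g a" for a
    by (intro pmf_embed_pmf) (auto simp: g_def assms)
  show ?thesis
  proof (rule that[of "embed_pmf g"])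
    show "set_pmf (embed_pmf g) \<subseteq> {..<k}"
      by (auto simp: set_pmf_iff p g_def split: if_splits)
  qed (simp add: p g_def)
qed

text \<open>Rounding \<open>N * \<alpha>(a)\<close> up to a positive integer and normalising costs a factor of at most
  \<open>N / (N + k)\<close>, which tends to \<open>1\<close>.\<close>

lemma rational_pmf_approx:
  fixes \<alpha> :: "nat pmf"
  assumes "set_pmf \<alpha> \<subseteq> {..<k}" and "k > 0" and "\<epsilon> > 0"
  obtains \<beta> where "set_pmf \<beta> \<subseteq> {..<k}" and "\<And>a. a < k \<Longrightarrow> pmf \<beta> a \<in> \<rat>"
    and "\<And>a. a < k \<Longrightarrow> pmf \<beta> a > 0"
    and "(\<Sum>a<k. pmf \<alpha> a * ln (pmf \<beta> a)) \<ge> (\<Sum>a<k. pmf \<alpha> a * ln (pmf \<alpha> a)) - \<epsilon>"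
proof -
  \<comment> \<open>Large enough that \<open>ln (1 + k / N) \<le> k / N \<le> \<epsilon>\<close>,
    the loss per letter.\<close>
  obtain N :: nat where "real k / \<epsilon> < real N" using reals_Archimedean2 by blast
  then have N: "real k < real N * \<epsilon>" using assms(3) by (simp add: divide_less_eq)
  then have N0: "N > 0" using assms(2) by (cases N) auto
  \<comment> \<open>Floor plus one, unlike the ceiling, is positive even where \<alpha>
    vanishes.\<close>
  define z where "z a = \<lfloor>real N * pmf \<alpha> a\<rfloor> + 1" for a
  have z_pos: "z a > 0" for a by (simp add: z_def add_pos_nonneg)
  define Z where "Z = (\<Sum>a<k. z a)"
  have Z_pos: "Z > 0" unfolding Z_def using assms(2) z_pos by (intro sum_pos) auto
  have "real_of_int Z \<le> (\<Sum>a<k. real N * pmf \<alpha> a + 1)"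
    unfolding Z_def of_int_sum by (intro sum_mono) (simp add: z_def)
  also have "\<dots> = real N + real k"
    using sum_pmf_lessThan[OF assms(1)] by (simp add: sum.distrib flip: sum_distrib_left)
  finally have Z_le: "real_of_int Z \<le> real N + real k" .
  obtain \<beta> where \<beta>: "set_pmf \<beta> \<subseteq> {..<k}" "\<And>a. a < k \<Longrightarrow> pmf \<beta> a = of_int (z a) / of_int Z"
  proof (rule exists_pmf_lessThan[of k "\<lambda>a. of_int (z a) / of_int Z"])
    show "(\<Sum>a<k. real_of_int (z a) / of_int Z) = 1"
      using Z_pos by (simp add: Z_def flip: sum_divide_distrib of_int_sum)
  qed (use z_pos Z_pos in \<open>auto simp: less_imp_le\<close>)
  have "pmf \<alpha> a * ln (pmf \<alpha> a) - pmf \<alpha> a * \<epsilon> \<le> pmf \<alpha> a * ln (pmf \<beta> a)" if "a < k" for a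
  proof (cases "pmf \<alpha> a = 0")
    case False
    then have pos: "pmf \<alpha> a > 0" by (simp add: pmf_pos)
    have "pmf \<alpha> a / (1 + k / N) = real N * pmf \<alpha> a / (real N + real k)"
      using N0 by (simp add: field_simps)
    also have "\<dots> \<le> of_int (z a) / of_int Z"
      using Z_pos Z_le z_pos[of a] by (intro frac_le) (auto simp: z_def intro: less_imp_le)
    finally have le: "pmf \<alpha> a / (1 + k / N) \<le> pmf \<beta> a" using \<beta>(2)[OF that] by simp
    have "ln (1 + k / N) \<le> k / N" by (rule ln_add_one_self_le_self) simp
    also have "\<dots> \<le> \<epsilon>" using N N0 by (simp add: divide_le_eq mult.commute)
    finally have "ln (pmf \<alpha> a) - \<epsilon> \<le> ln (pmf \<alpha> a) - ln (1 + k / N)" by simp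
    also have "\<dots> = ln (pmf \<alpha> a / (1 + k / N))"
      using pos by (simp add: ln_divide_pos add_pos_nonneg)
    also have "\<dots> \<le> ln (pmf \<beta> a)"
      using le pos by (intro ln_mono) (auto simp: add_pos_nonneg)
    finally have "pmf \<alpha> a * (ln (pmf \<alpha> a) - \<epsilon>) \<le> pmf \<alpha> a * ln (pmf \<beta> a)"
      using pos by (intro mult_left_mono) auto
    then show ?thesis by (simp add: algebra_simps)
  qed simp
  then have "(\<Sum>a<k. pmf \<alpha> a * ln (pmf \<alpha> a) - pmf \<alpha> a * \<epsilon>) \<le> (\<Sum>a<k. pmf \<alpha> a * ln (pmf \<beta> a))"
    by (intro sum_mono) auto
  moreover have "(\<Sum>a<k. pmf \<alpha> a * ln (pmf \<alpha> a) - pmf \<alpha> a * \<epsilon>) =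
      (\<Sum>a<k. pmf \<alpha> a * ln (pmf \<alpha> a)) - \<epsilon>"
    using sum_pmf_lessThan[OF assms(1)] by (simp add: sum_subtractf flip: sum_distrib_right)
  ultimately show ?thesis
    using \<beta> z_pos Z_pos by (intro that[of \<beta>]) auto
qed

lemma exists_gambler_s_gale_at_top:
  assumes "k \<ge> 2" and "set_pmf \<alpha> \<subseteq> {..<k}" and "\<forall>i. R i < k" and "normal_seq k \<alpha> R"
    and "entropy_base k \<alpha> < s"
  obtains G :: "nat gambler" where "FSG k G"
    and "filterlim (\<lambda>n. s_gale k G s (seq_prefix R n)) at_top sequentially"
proof -
  define K where "K = ln (real k)"
  have K: "K > 0" using assms(1) by (simp add: K_def)
  \<comment> \<open>Half the gap between \<open>s\<close> and the entropy, in natural logarithms: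
    approximating \<alpha> costs at most \<epsilon> and leaves a growth rate of at least
    \<epsilon>.\<close>
  define \<epsilon> where "\<epsilon> = (s - entropy_base k \<alpha>) * K / 2"
  have \<epsilon>: "\<epsilon> > 0" using K assms(5) by (simp add: \<epsilon>_def)
  \<comment> \<open>Every letter needs a positive bet: \<open>R\<close> may contain letters of
    probability 0, with limiting frequency 0, and a zero bet would lose everything.\<close>
  obtain \<beta> where \<beta>: "set_pmf \<beta> \<subseteq> {..<k}" "\<And>a. a < k \<Longrightarrow> pmf \<beta> a \<in> \<rat>"
    "\<And>a. a < k \<Longrightarrow> pmf \<beta> a > 0"
    "(\<Sum>a<k. pmf \<alpha> a * ln (pmf \<beta> a)) \<ge> (\<Sum>a<k. pmf \<alpha> a * ln (pmf \<alpha> a)) - \<epsilon>"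
    by (rule rational_pmf_approx[OF assms(2) _ \<epsilon>]) (use assms(1) in auto)
  define G :: "nat gambler" where
    "G = \<lparr>states = {0}, trans = (\<lambda>_ _. 0), start = 0, bet = (\<lambda>_. \<beta>)\<rparr>"
  have G: "FSG k G" using \<beta> by (auto simp: FSG_def G_def)
  define f where "f w = ln (pmf \<beta> (hd w))" for w
  \<comment> \<open>The logarithmic growth rate of the \<open>s\<close>-gale per letter; letters are
    blocks of length 1.\<close>
  define c where "c n = s * K + (\<Sum>m<n. f (block R 1 m)) / real n" for n
  have "(\<Sum>w\<in>words k 1. word_prob \<alpha> w * f w) = (\<Sum>a<k. pmf \<alpha> a * ln (pmf \<beta> a))"
    using sum_words_Suc[of _ k 0] by (simp add: word_prob_def f_def)
  then have "c \<longlonglongrightarrow> s * K + (\<Sum>a<k. pmf \<alpha> a * ln (pmf \<beta> a))"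
    unfolding c_def using block_average_tendsto[OF assms(4,3), of 1 f]
    by (intro tendsto_add tendsto_const) simp
  moreover have "2 * \<epsilon> = s * K + (\<Sum>a<k. pmf \<alpha> a * ln (pmf \<alpha> a))"
    using entropy_base_ln[OF assms(1), of \<alpha>] by (simp add: \<epsilon>_def K_def left_diff_distrib)
  then have "s * K + (\<Sum>a<k. pmf \<alpha> a * ln (pmf \<beta> a)) > 0"
    using \<beta>(4) \<epsilon> by linarith
  ultimately have "filterlim (\<lambda>n. c n * real n) at_top sequentially"
    by (rule filterlim_tendsto_pos_mult_at_top) (rule filterlim_real_sequentially)
  moreover have "s_gale k G s (seq_prefix R n) = exp (c n * real n)" for n
  proof -
    have "martingale k G (seq_prefix R n) = exp (real n * K + (\<Sum>m<n. f (block R 1 m)))"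
    proof (induction n)
      case 0
      then show ?case by (simp add: seq_prefix_def)
    next
      case (Suc n)
      have "martingale k G (seq_prefix R (Suc n)) =
          real k * martingale k G (seq_prefix R n) * pmf \<beta> (R n)"
        by (simp add: seq_prefix_def G_def)
      then show ?case
        using Suc \<beta>(3)[of "R n"] assms(1,3)
        by (simp add: f_def block_def K_def exp_add algebra_simps)
    qed
    then have "s_gale k G s (seq_prefix R n) = exp (s * real n * K + (\<Sum>m<n. f (block R 1 m)))"
      unfolding s_gale_seq_prefix[OF assms(1)]
      by (simp add: K_def algebra_simps flip: exp_add)
    also have "s * real n * K + (\<Sum>m<n. f (block R 1 m)) = c n * real n"
      \<comment> \<open>\<open>c n\<close> divides by \<open>n\<close>; for \<open>n = 0\<close>
        both sides are 0.\<close>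
      by (cases "n = 0") (simp_all add: c_def algebra_simps)
    finally show ?thesis .
  qed
  ultimately have "filterlim (\<lambda>n. s_gale k G s (seq_prefix R n)) at_top sequentially"
    by (simp add: filterlim_compose[OF exp_at_top])
  with G show ?thesis by (rule that)
qed

text \<open>The set lies between the open and the closed half-line from \<open>h\<close>, so it can
  stay undecided whether \<open>h\<close> itself belongs to it.\<close>

lemma cInf_eq_threshold:
  fixes A :: "real set"
  assumes "\<And>s. s \<in> A \<Longrightarrow> h \<le> s" and "\<And>s. h < s \<Longrightarrow> s \<in> A"
  shows "Inf A = h"
proof (rule antisym)
  have bdd: "bdd_below A" using assms(1) by (rule bdd_belowI)
  show "Inf A \<le> h"
    by (rule dense_ge) (use assms(2) bdd in \<open>auto intro: cInf_lower\<close>)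
  show "h \<le> Inf A"
    using assms(2)[of "h + 1"] by (intro cInf_greatest assms(1)) auto
qed

theorem theorem5p3:
  fixes k :: nat and \<alpha> :: "nat pmf" and R :: "nat \<Rightarrow> nat"
  assumes "k \<ge> 2"
    and "set_pmf \<alpha> \<subseteq> {..<k}"
    and "\<forall>i. R i < k"
    and "normal_seq k \<alpha> R"
  shows "dim_FS k R = entropy_base k \<alpha> \<and> Dim_FS k R = entropy_base k \<alpha>"
proof -
  let ?X = "\<lambda>(G :: nat gambler) s n. ereal (s_gale k G s (seq_prefix R n))"
  \<comment> \<open>The lower bound refutes the weaker success condition (limsup), and
    \<open>upper\<close> provides the stronger one (liminf), so each serves both dimensions.\<close>
  have lower: "entropy_base k \<alpha> \<le> s"
    if s: "s \<ge> 0" "FSG k G" "limsup (?X G s) = \<infinity>" for s and G :: "nat gambler"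
  proof (rule ccontr)
    assume "\<not> entropy_base k \<alpha> \<le> s"
    then obtain C where "eventually (\<lambda>n. s_gale k G s (seq_prefix R n) \<le> C) sequentially"
      using s_gale_eventually_bounded[OF assms s(2,1)] by (auto simp: not_le)
    then have "limsup (?X G s) \<le> ereal C"
      by (intro Limsup_bounded) simp
    with s(3) show False by simp
  qed
  have liminf_limsup: "limsup (?X G s) = \<infinity>" if "liminf (?X G s) = \<infinity>" for s G
    using Liminf_le_Limsup[OF trivial_limit_sequentially, of "?X G s"] that by simp
  have upper: "s \<ge> 0 \<and> (\<exists>G. FSG k G \<and> liminf (?X G s) = \<infinity>)" if s: "entropy_base k \<alpha> < s" for s
  proof -
    obtain G :: "nat gambler" where G: "FSG k G"
      "filterlim (\<lambda>n. s_gale k G s (seq_prefix R n)) at_top sequentially"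
      using exists_gambler_s_gale_at_top[OF assms s] .
    from G(2) have "?X G s \<longlonglongrightarrow> \<infinity>" by (simp add: tendsto_PInfty_eq_at_top)
    then have "liminf (?X G s) = \<infinity>"
      by (rule lim_imp_Liminf[OF trivial_limit_sequentially])
    with G(1) entropy_base_nonneg[OF assms(1), of \<alpha>] s show ?thesis by auto
  qed
  have "dim_FS k R = entropy_base k \<alpha>"
    unfolding dim_FS_def
    by (rule cInf_eq_threshold) (use lower upper liminf_limsup in blast)+
  moreover have "Dim_FS k R = entropy_base k \<alpha>"
    unfolding Dim_FS_def
    by (rule cInf_eq_threshold) (use lower upper liminf_limsup in blast)+
  ultimately show ?thesis ..
qed

end
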